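(* Let $n_1,n_2,n_3$ be non-zero integers such that $|n_1|,|n_2|,|n_3|$ are distinct and $\gcd(n_1,n_2,n_3)=1$. Let $m=\gcd(n_2,n_3)$, and suppose that $r>0$ is such that $(1/m,0)$ and $(r/n_3,m/n_3)$ generate the lattice $\mathcal K=\mathbb Z(1,0)+\mathbb Z(0,1)+\mathbb Z\left(\frac{n_1}{n_3},\frac{n_2}{n_3}\right)\subset\mathbb R^2$ (as an additive group). Then the angular Kronecker constant $\alpha\{n_1,n_2,n_3\}$ satisfies $$ \alpha\{n_1,n_2,n_3\}\ \geq\ \frac{|n_3|}{2\left(r(|n_2|+|n_3|)+m(|n_1|+|n_3|)\right)} $$ and $$ \alpha\{n_1,n_2,n_3\}\ \leq\ \frac{E_1\left(2|n_1||n_2|+|n_3|(|n_1|+|n_2|)\right)}{|n_3|(|n_1|+|n_2|)}, $$ where $$ E_1=\max\left(\frac{m}{2(|n_2|+|n_3|)},\ \frac{r}{2(|n_1|+|n_3|)},\ \frac{|n_3|+2rm}{2\left(r(|n_2|+|n_3|)+m(|n_1|+|n_3|)\right)}\right). $$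
   Context: For a finite set $S$ of integers, the Kronecker constant $\kappa(S)$ is the infimum of all $\varepsilon>0$ such that for every function $f:S\to\mathbb T=\{z\in\mathbb C:|z|=1\}$ there exists $x\in\mathbb R$ with $|e^{2\pi i n x}-f(n)|<\varepsilon$ for all $n\in S$. The angular Kronecker constant $\alpha(S)\in[0,1/2]$ is defined by $\kappa(S)=|e^{2\pi i\alpha(S)}-1|$. Equivalently, $\alpha(S)$ is the infimum of all $E\ge 0$ such that for every choice of real numbers $(\theta_n)_{n\in S}$ there is $x\in\mathbb R$ such that the distance from $nx-\theta_n$ to the nearest integer is at most $E$ for every $n\in S$. We write $\alpha\{n_1,n_2,n_3\}$ for $\alpha(\{n_1,n_2,n_3\})$. *)

theory Defs
  imports "HOL-Analysis.Analysis" "HOL-Computational_Algebra.Group_Closure"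
begin

definition kronecker_const :: "int set \<Rightarrow> real" where
  "kronecker_const S = Inf {\<epsilon>. \<epsilon> > 0 \<and>
     (\<forall>f :: int \<Rightarrow> complex. (\<forall>n\<in>S. cmod (f n) = 1) \<longrightarrow>
        (\<exists>x::real. \<forall>n\<in>S. cmod (exp (2 * of_real pi * \<i> * of_int n * of_real x) - f n) < \<epsilon>))}"

definition angular_kronecker_const :: "int set \<Rightarrow> real" where
  "angular_kronecker_const S =
     (THE a. 0 \<le> a \<and> a \<le> 1/2 \<and>
        kronecker_const S = cmod (exp (2 * of_real pi * \<i> * of_real a) - 1))"

lemma cmod_exp_minus_one:
  assumes "0 \<le> a" "a \<le> 1/2"
  shows "cmod (exp (2 * of_real pi * \<i> * of_real a) - 1) = 2 * sin (pi * a)"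
proof -
  have "cmod (exp (2 * of_real pi * \<i> * of_real a) - 1) = cmod (exp (\<i> * of_real (2 * pi * a)) - 1)"
    by (simp add: mult_ac)
  also have "\<dots> = 2 * \<bar>sin (pi * a)\<bar>"
    using dist_exp_i_1[of "2 * pi * a"] by (simp add: dist_norm)
  also have "sin (pi * a) \<ge> 0"
    using assms by (intro sin_ge_zero) auto
  then have "2 * \<bar>sin (pi * a)\<bar> = 2 * sin (pi * a)" by simp
  finally show ?thesis .
qed

lemma kronecker_const_bounds: "0 \<le> kronecker_const S" "kronecker_const S \<le> 2"
proof -
  define A where "A = {\<epsilon>::real. \<epsilon> > 0 \<and>
     (\<forall>f :: int \<Rightarrow> complex. (\<forall>n\<in>S. cmod (f n) = 1) \<longrightarrow>
        (\<exists>x::real. \<forall>n\<in>S. cmod (exp (2 * of_real pi * \<i> * of_int n * of_real x) - f n) < \<epsilon>))}"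
  have eq: "kronecker_const S = Inf A"
    by (simp add: kronecker_const_def A_def)
  have mem: "e \<in> A" if "e > 2" for e
  proof -
    have "cmod (exp (2 * of_real pi * \<i> * of_int n * of_real 0) - f n) < e"
      if "cmod (f n) = 1" for f :: "int \<Rightarrow> complex" and n
      using norm_triangle_ineq4[of 1 "f n"] that \<open>e > 2\<close> by simp
    then show ?thesis
      using \<open>e > 2\<close> unfolding A_def by fastforce
  qed
  have bdd: "bdd_below A"
    by (rule bdd_belowI[of _ 0]) (auto simp: A_def)
  show "0 \<le> kronecker_const S"
    unfolding eq
  proof (rule cInf_greatest)
    show "A \<noteq> {}" using mem[of 3] by auto
    show "0 \<le> e" if "e \<in> A" for e
      using that unfolding A_def by simp
  qed
  show "kronecker_const S \<le> 2"
    unfolding eq by (rule dense_ge) (use mem bdd in \<open>auto intro: cInf_lower\<close>)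
qed

lemma angular_kronecker_const_ex1:
  "\<exists>!a. 0 \<le> a \<and> a \<le> 1/2 \<and>
     kronecker_const S = cmod (exp (2 * of_real pi * \<i> * of_real a) - 1)"
proof -
  let ?k = "kronecker_const S"
  have bounds: "- (pi / 2) \<le> pi * a" "pi * a \<le> pi / 2" if "0 \<le> a" "a \<le> 1/2" for a :: real
  proof -
    have "0 \<le> pi * a"
      using that(1) by simp
    then show "- (pi / 2) \<le> pi * a"
      using pi_ge_zero by linarith
    show "pi * a \<le> pi / 2"
      using mult_left_mono[OF that(2) pi_ge_zero] by simp
  qed
  have inj: "a = b"
    if "0 \<le> a" "a \<le> 1/2" "0 \<le> b" "b \<le> 1/2" "sin (pi * a) = sin (pi * b)" for a b :: real
    using sin_inj_pi[OF bounds[OF that(1,2)] bounds[OF that(3,4)] that(5)] by simp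
  have k: "0 \<le> ?k / 2" "?k / 2 \<le> 1"
    using kronecker_const_bounds[of S] by auto
  define a where "a = arcsin (?k / 2) / pi"
  have "0 \<le> a"
    unfolding a_def using k arcsin_le_arcsin[of 0 "?k / 2"] by simp
  have "a \<le> 1/2"
    unfolding a_def using k arcsin_ubound[of "?k / 2"] by (simp add: field_simps)
  have "2 * sin (pi * a) = ?k"
    unfolding a_def using k by simp
  show ?thesis
  proof (intro ex1I[of _ a] conjI)
    show "0 \<le> a" "a \<le> 1/2" by fact+
    show "?k = cmod (exp (2 * of_real pi * \<i> * of_real a) - 1)"
      using cmod_exp_minus_one[OF \<open>0 \<le> a\<close> \<open>a \<le> 1/2\<close>] \<open>2 * sin (pi * a) = ?k\<close> by simp
    show "b = a"
      if b: "0 \<le> b \<and> b \<le> 1/2 \<and> ?k = cmod (exp (2 * of_real pi * \<i> * of_real b) - 1)" for b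
    proof -
      from b have b': "0 \<le> b" "b \<le> 1/2" by blast+
      have "sin (pi * b) = sin (pi * a)"
        using b cmod_exp_minus_one[OF b'] \<open>2 * sin (pi * a) = ?k\<close> by simp
      then show ?thesis
        by (rule inj[OF b' \<open>0 \<le> a\<close> \<open>a \<le> 1/2\<close>])
    qed
  qed
qed

definition lattice_K :: "int \<Rightarrow> int \<Rightarrow> int \<Rightarrow> (real \<times> real) set" where
  "lattice_K n1 n2 n3 =
     {of_int a *\<^sub>R (1, 0) + of_int b *\<^sub>R (0, 1) + of_int c *\<^sub>R (of_int n1 / of_int n3, of_int n2 / of_int n3)
      | a b c :: int. True}"

end

theory Submission
  imports Defs
begin

text \<open>Write \<open>n3 x = \<theta>3 + k + \<delta>\<close> with \<open>\<bar>\<delta>\<bar> \<le> E\<close>. Eliminating \<open>x\<close> shows that the angular Kronecker constant is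
  the smallest \<open>E\<close> for which the translates by \<open>K\<close> of the hexagon \<open>E Z\<close> cover the plane, where
  \<open>Z = [-1,1]\<^sup>2 + [-1,1] (n1/n3, n2/n3)\<close>. The hexagon \<open>E Z\<close> lies in the rectangle with half sides
  \<open>E (1 + \<bar>n1/n3\<bar>)\<close> and \<open>E (1 + \<bar>n2/n3\<bar>)\<close>, and it contains the rectangle belonging to
  \<open>E1 = E \<bar>n3\<bar> (\<bar>n1\<bar> + \<bar>n2\<bar>) / (2 \<bar>n1\<bar> \<bar>n2\<bar> + \<bar>n3\<bar> (\<bar>n1\<bar> + \<bar>n2\<bar>))\<close>, so both bounds reduce to
  rectangles. For the lower bound it suffices that the point \<open>(1/(2m), 0)\<close> is covered: it is halfway
  between two lattice points of its row, and the rectangle covering it is centred at most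
  \<open>h \<bar>n3\<bar>/m\<close> rows away, so at horizontal distance at least \<open>1/(2m) - h r/m\<close>, where \<open>h\<close> is its
  vertical half side.\<close>

section \<open>Chord lengths and distances to the nearest integer\<close>

lemma sin_pi_le_iff:
  assumes "0 \<le> a" "a \<le> 1/2" "0 \<le> b" "b \<le> 1/2"
  shows "sin (pi * a) \<le> sin (pi * b) \<longleftrightarrow> a \<le> b"
proof -
  have "- (pi / 2) \<le> pi * c" "pi * c \<le> pi / 2" if "0 \<le> c" "c \<le> 1/2" for c :: real
  proof -
    have "0 \<le> pi * c"
      using that(1) by simp
    then show "- (pi / 2) \<le> pi * c"
      using pi_ge_zero by linarith
    show "pi * c \<le> pi / 2"
      using mult_left_mono[OF that(2) pi_ge_zero] by simp
  qed
  then show ?thesis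
    using assms by (simp add: sin_mono_le_eq)
qed

lemma abs_sin_pi_diff_of_int: "\<bar>sin (pi * (t - of_int k))\<bar> = \<bar>sin (pi * t)\<bar>"
proof -
  have "\<bar>cos (pi * of_int k)\<bar> = 1"
    by (intro sin_zero_abs_cos_one) (simp add: sin_zero_iff_int2 mult.commute)
  moreover have "sin (pi * of_int k) = 0"
    by (simp add: sin_zero_iff_int2 mult.commute)
  ultimately show ?thesis
    by (simp add: right_diff_distrib sin_diff abs_mult)
qed

lemma abs_sin_pi_eq_sin_pi_abs:
  assumes "\<bar>t\<bar> \<le> 1"
  shows "\<bar>sin (pi * t)\<bar> = sin (pi * \<bar>t\<bar>)"
proof -
  have "0 \<le> sin (pi * \<bar>t\<bar>)"
    using assms by (intro sin_ge_zero) auto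
  then show ?thesis
    by (cases "t \<ge> 0") auto
qed

text \<open>Rotating by the second point leaves a chord from 1, whose length depends only on the
  phase difference; the sine then no longer sees integer shifts of that difference.\<close>

lemma cmod_exp_diff:
  "cmod (exp (2 * of_real pi * \<i> * of_int n * of_real x) - exp (2 * of_real pi * \<i> * of_real t))
    = 2 * \<bar>sin (pi * (of_int n * x - t))\<bar>"
proof -
  have "exp (2 * of_real pi * \<i> * of_int n * of_real x) - exp (2 * of_real pi * \<i> * of_real t)
    = exp (\<i> * of_real (2 * pi * t)) * (exp (\<i> * of_real (2 * pi * (of_int n * x - t))) - 1)"
    by (simp add: algebra_simps flip: exp_add)
  then have "cmod (exp (2 * of_real pi * \<i> * of_int n * of_real x) - exp (2 * of_real pi * \<i> * of_real t))
    = cmod (exp (\<i> * of_real (2 * pi * (of_int n * x - t))) - 1)"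
    by (simp only: norm_mult norm_exp_i_times mult_1)
  also have "\<dots> = 2 * \<bar>sin (pi * (of_int n * x - t))\<bar>"
    by (simp only: dist_exp_i_1) simp
  finally show ?thesis .
qed

lemma cmod_exp_eq_1: "cmod (exp (2 * of_real pi * \<i> * of_real t)) = 1"
  using norm_exp_i_times[of "2 * pi * t"] by (simp add: mult_ac)

lemma cmod_eq_1_obtain_angle:
  assumes "cmod z = 1"
  obtains t :: real where "z = exp (2 * of_real pi * \<i> * of_real t)"
proof
  show "z = exp (2 * of_real pi * \<i> * of_real (Arg z / (2 * pi)))"
    using Arg_eq[of z] assms by (cases "z = 0") (auto simp: mult_ac)
qed

section \<open>The angular constant in terms of simultaneous approximation modulo 1\<close>

lemma angular_kronecker_const:
  "0 \<le> angular_kronecker_const S" "angular_kronecker_const S \<le> 1/2"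
  "kronecker_const S = 2 * sin (pi * angular_kronecker_const S)"
  using theI'[OF angular_kronecker_const_ex1[of S], folded angular_kronecker_const_def]
    cmod_exp_minus_one[of "angular_kronecker_const S"] by auto

text \<open>Every unimodular \<open>f\<close> has phases \<open>\<theta>\<close>, and on
  \<open>[0, 1/2]\<close> the chord length grows with the angle, so a uniform bound on angles is a
  uniform bound on chords.\<close>

lemma angular_kronecker_const_le:
  assumes "0 \<le> E"
    and approx: "\<And>\<theta> :: int \<Rightarrow> real. \<exists>x::real. \<forall>n\<in>S. \<exists>k::int. \<bar>of_int n * x - \<theta> n - of_int k\<bar> \<le> E"
  shows "angular_kronecker_const S \<le> E"
proof (cases "E \<le> 1/2")
  case False
  then show ?thesis using angular_kronecker_const(2)[of S] by simp
next
  case True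
  have sin0: "0 \<le> sin (pi * E)"
    using sin_pi_le_iff[of 0 E] assms(1) True by simp
  \<comment> \<open>The infimum is taken over strict bounds, while \<open>E\<close> is a non-strict
    one. Hence only the numbers above \<open>2 * sin (pi * E)\<close> are shown to be admissible,
    and density gives the limit.\<close>
  have "kronecker_const S \<le> \<epsilon>" if "2 * sin (pi * E) < \<epsilon>" for \<epsilon>
    unfolding kronecker_const_def
  proof (rule cInf_lower)
    show "bdd_below {\<epsilon>. \<epsilon> > 0 \<and>
     (\<forall>f :: int \<Rightarrow> complex. (\<forall>n\<in>S. cmod (f n) = 1) \<longrightarrow>
        (\<exists>x::real. \<forall>n\<in>S. cmod (exp (2 * of_real pi * \<i> * of_int n * of_real x) - f n) < \<epsilon>))}"
      by (rule bdd_belowI[of _ 0]) auto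
    have "\<exists>x::real. \<forall>n\<in>S. cmod (exp (2 * of_real pi * \<i> * of_int n * of_real x) - f n) < \<epsilon>"
      if f: "\<forall>n\<in>S. cmod (f n) = 1" for f :: "int \<Rightarrow> complex"
    proof -
      have "\<forall>n\<in>S. \<exists>t::real. f n = exp (2 * of_real pi * \<i> * of_real t)"
        using f cmod_eq_1_obtain_angle by metis
      then obtain \<theta> :: "int \<Rightarrow> real" where \<theta>: "\<And>n. n \<in> S \<Longrightarrow> f n = exp (2 * of_real pi * \<i> * of_real (\<theta> n))"
        by metis
      obtain x where x: "\<forall>n\<in>S. \<exists>k::int. \<bar>of_int n * x - \<theta> n - of_int k\<bar> \<le> E"
        using approx by blast
      have "cmod (exp (2 * of_real pi * \<i> * of_int n * of_real x) - f n) < \<epsilon>" if n: "n \<in> S" for n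
      proof -
        obtain k :: int where k: "\<bar>of_int n * x - \<theta> n - of_int k\<bar> \<le> E"
          using x n by blast
        have "\<bar>sin (pi * (of_int n * x - \<theta> n))\<bar> = \<bar>sin (pi * (of_int n * x - \<theta> n - of_int k))\<bar>"
          by (simp only: abs_sin_pi_diff_of_int)
        also have "\<dots> = sin (pi * \<bar>of_int n * x - \<theta> n - of_int k\<bar>)"
          using k True by (intro abs_sin_pi_eq_sin_pi_abs) linarith
        also have "\<dots> \<le> sin (pi * E)"
          using k True assms(1) by (subst sin_pi_le_iff) auto
        finally show ?thesis
          using \<open>2 * sin (pi * E) < \<epsilon>\<close> by (simp add: \<theta>[OF n] cmod_exp_diff)
      qed
      then show ?thesis by blast
    qed
    then show "\<epsilon> \<in> {\<epsilon>. \<epsilon> > 0 \<and>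
     (\<forall>f :: int \<Rightarrow> complex. (\<forall>n\<in>S. cmod (f n) = 1) \<longrightarrow>
        (\<exists>x::real. \<forall>n\<in>S. cmod (exp (2 * of_real pi * \<i> * of_int n * of_real x) - f n) < \<epsilon>))}"
      using sin0 that by simp
  qed
  then have "kronecker_const S \<le> 2 * sin (pi * E)"
    by (rule dense_ge)
  then show ?thesis
    using angular_kronecker_const[of S] sin_pi_le_iff[of "angular_kronecker_const S" E] assms(1) True
    by simp
qed

text \<open>The converse direction: below \<open>E\<close> there is room for an admissible
  \<open>\<epsilon>\<close>, which is applied to the function with phases
  \<open>\<theta>\<close>.\<close>

lemma angular_kronecker_const_less_approx:
  fixes \<theta> :: "int \<Rightarrow> real"
  assumes "angular_kronecker_const S < E"
  obtains x :: real where "\<And>n. n \<in> S \<Longrightarrow> \<exists>k::int. \<bar>of_int n * x - \<theta> n - of_int k\<bar> < E"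
proof (cases "E \<le> 1/2")
  case False
  \<comment> \<open>Every real is within 1/2 of an integer, so \<open>x = 0\<close> serves
    here.\<close>
  have "\<bar>of_int n * 0 - \<theta> n - of_int (round (- \<theta> n))\<bar> < E" for n
    using of_int_round_abs_le[of "- \<theta> n"] False by linarith
  then show ?thesis using that by blast
next
  case True
  have E: "0 \<le> E"
    using assms angular_kronecker_const(1)[of S] by simp
  have "kronecker_const S < 2 * sin (pi * E)"
    using angular_kronecker_const[of S] sin_pi_le_iff[of E "angular_kronecker_const S"] assms E True
    by (simp add: not_le[symmetric])
  moreover have "{\<epsilon>. \<epsilon> > 0 \<and>
     (\<forall>f :: int \<Rightarrow> complex. (\<forall>n\<in>S. cmod (f n) = 1) \<longrightarrow>
        (\<exists>x::real. \<forall>n\<in>S. cmod (exp (2 * of_real pi * \<i> * of_int n * of_real x) - f n) < \<epsilon>))} \<noteq> {}"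
  proof -
    \<comment> \<open>Any number above the diameter 2 of the circle is admissible; this makes the
      infimum one of a nonempty set.\<close>
    have "cmod (exp (2 * of_real pi * \<i> * of_int n * of_real 0) - f n) < 3"
      if "cmod (f n) = 1" for f :: "int \<Rightarrow> complex" and n
      using norm_triangle_ineq4[of 1 "f n"] that by simp
    then have "(3::real) \<in> {\<epsilon>. \<epsilon> > 0 \<and>
     (\<forall>f :: int \<Rightarrow> complex. (\<forall>n\<in>S. cmod (f n) = 1) \<longrightarrow>
        (\<exists>x::real. \<forall>n\<in>S. cmod (exp (2 * of_real pi * \<i> * of_int n * of_real x) - f n) < \<epsilon>))}"
      by fastforce
    then show ?thesis by blast
  qed
  ultimately obtain \<epsilon> where "\<epsilon> < 2 * sin (pi * E)"
    and \<epsilon>: "\<And>f :: int \<Rightarrow> complex. (\<forall>n\<in>S. cmod (f n) = 1) \<Longrightarrow>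
        (\<exists>x::real. \<forall>n\<in>S. cmod (exp (2 * of_real pi * \<i> * of_int n * of_real x) - f n) < \<epsilon>)"
    unfolding kronecker_const_def by (fastforce dest!: cInf_lessD[rotated])
  obtain x :: real where x: "\<And>n. n \<in> S \<Longrightarrow> 2 * \<bar>sin (pi * (of_int n * x - \<theta> n))\<bar> < \<epsilon>"
    using \<epsilon>[of "\<lambda>n. exp (2 * of_real pi * \<i> * of_real (\<theta> n))"]
    by (auto simp only: cmod_exp_eq_1 cmod_exp_diff)
  \<comment> \<open>Subtracting the nearest integer brings the phase into the range where the sine
    is monotone, so the chord estimate can be inverted.\<close>
  have "\<bar>of_int n * x - \<theta> n - of_int (round (of_int n * x - \<theta> n))\<bar> < E" if n: "n \<in> S" for n
  proof -
    let ?t = "of_int n * x - \<theta> n - of_int (round (of_int n * x - \<theta> n))"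
    have t: "\<bar>?t\<bar> \<le> 1/2"
      using of_int_round_abs_le[of "of_int n * x - \<theta> n"] by (simp add: abs_minus_commute)
    have "sin (pi * \<bar>?t\<bar>) = \<bar>sin (pi * ?t)\<bar>"
      using t by (subst abs_sin_pi_eq_sin_pi_abs) linarith+
    also have "\<dots> = \<bar>sin (pi * (of_int n * x - \<theta> n))\<bar>"
      by (rule abs_sin_pi_diff_of_int)
    also have "\<dots> < sin (pi * E)"
      using x[OF n] \<open>\<epsilon> < 2 * sin (pi * E)\<close> by simp
    finally show ?thesis
      using sin_pi_le_iff[of E "\<bar>?t\<bar>"] t E True by (simp add: not_le[symmetric])
  qed
  then show ?thesis using that by blast
qed

section \<open>The lattice in rows, and covers by rectangles\<close>

lemma of_int_scaleR_in_group_closure: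
  fixes v :: "'a :: real_vector"
  assumes "v \<in> group_closure S"
  shows "of_int k *\<^sub>R v \<in> group_closure S"
proof (induction k rule: int_induct[of _ 0])
  case base
  show ?case by simp
next
  case (step1 i)
  then show ?case
    using group_closure_add[OF step1.IH assms] by (simp add: scaleR_left_distrib)
next
  case (step2 i)
  then show ?case
    using group_closure.diff[OF step2.IH assms] by (simp add: scaleR_left_diff_distrib)
qed

text \<open>This presents the lattice as horizontal rows: row \<open>j\<close> has height
  \<open>j * t\<close>, spacing \<open>p\<close> and offset \<open>j * s\<close>.\<close>

lemma group_closure_pair_iff:
  fixes p s t :: real
  shows "v \<in> group_closure {(p, 0), (s, t)} \<longleftrightarrow>
    (\<exists>i j :: int. v = (of_int i * p + of_int j * s, of_int j * t))"
proof
  assume "v \<in> group_closure {(p, 0), (s, t)}"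
  then show "\<exists>i j :: int. v = (of_int i * p + of_int j * s, of_int j * t)"
  proof (induction rule: group_closure.induct)
    case (base u)
    then consider "u = (of_int 0 * p + of_int 0 * s, of_int 0 * t)"
      | "u = (of_int 1 * p + of_int 0 * s, of_int 0 * t)"
      | "u = (of_int 0 * p + of_int 1 * s, of_int 1 * t)"
      by (auto simp: zero_prod_def)
    then show ?case by cases blast+
  next
    case (diff u a)
    then obtain i j :: int where u: "u = (of_int i * p + of_int j * s, of_int j * t)" by blast
    moreover obtain k l :: int where "a = (of_int k * p + of_int l * s, of_int l * t)"
      using diff.IH(2) by blast
    ultimately have "u - a = (of_int (i - k) * p + of_int (j - l) * s, of_int (j - l) * t)"
      by (simp add: algebra_simps)
    then show ?case by blast
  qed
next
  assume "\<exists>i j :: int. v = (of_int i * p + of_int j * s, of_int j * t)"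
  then obtain i j :: int where "v = of_int i *\<^sub>R (p, 0) + of_int j *\<^sub>R (s, t)" by auto
  then show "v \<in> group_closure {(p, 0), (s, t)}"
    by (simp only:) (intro group_closure_add of_int_scaleR_in_group_closure group_closure.base; simp)
qed

lemma lattice_K_iff:
  "v \<in> lattice_K n1 n2 n3 \<longleftrightarrow>
    (\<exists>a b c :: int. v = (of_int a + of_int c * (of_int n1 / of_int n3), of_int b + of_int c * (of_int n2 / of_int n3)))"
  by (auto simp: lattice_K_def)

text \<open>The points of a fixed height \<open>y\<close> are covered by at least \<open>2 * h / t - 1\<close> consecutive rows of
  rectangles. As \<open>s \<le> 2 * w\<close>, the corresponding intervals leave no gaps, so together they form
  an interval at least as long as the horizontal period \<open>p\<close>.\<close>

lemma lattice_rectangle_cover: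
  fixes p s t w h x y :: real
  assumes pos: "0 < p" "0 < s" "0 < t"
    and t: "t \<le> 2 * h" and s: "s \<le> 2 * w" and p: "p \<le> 2 * w + s * (2 * h / t - 2)"
  obtains i j :: int where "\<bar>x + of_int i * p + of_int j * s\<bar> \<le> w" "\<bar>y + of_int j * t\<bar> \<le> h"
proof -
  \<comment> \<open>\<open>j0\<close> and \<open>j1\<close> are the lowest and the highest row whose
    translate of \<open>y\<close> stays in \<open>[-h, h]\<close>.\<close>
  define j0 where "j0 = \<lceil>(- h - y) / t\<rceil>"
  define j1 where "j1 = \<lfloor>(h - y) / t\<rfloor>"
  have j0: "- h \<le> y + of_int j0 * t" "y + of_int j0 * t < - h + t"
    using ceiling_correct[of "(- h - y) / t", folded j0_def] pos by (auto simp: field_simps)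
  have j1: "y + of_int j1 * t \<le> h"
    using floor_correct[of "(h - y) / t", folded j1_def] pos by (auto simp: field_simps)
  have "of_int j0 < (- h - y) / t + 1" "of_int j1 > (h - y) / t - 1"
    unfolding j0_def j1_def by linarith+
  moreover have "(h - y) / t - 1 - ((- h - y) / t + 1) = 2 * h / t - 2"
    using pos by (simp add: field_simps)
  ultimately have "2 * h / t - 2 \<le> of_int (j1 - j0)"
    by simp
  then have M: "p \<le> 2 * w + s * of_int (j1 - j0)"
    using mult_left_mono[of "2 * h / t - 2" "of_int (j1 - j0)" s] pos p by linarith
  \<comment> \<open>The period \<open>p\<close> moves the abscissa in row \<open>j0\<close> to the
    last position not beyond \<open>w\<close>. If it falls short of \<open>-w\<close>, the later
    rows, each adding \<open>s\<close>, have to make up for it.\<close>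
  define i where "i = \<lfloor>(w - x - of_int j0 * s) / p\<rfloor>"
  define z where "z = x + of_int i * p + of_int j0 * s"
  have z: "z \<le> w" "w - p < z"
    using floor_correct[of "(w - x - of_int j0 * s) / p", folded i_def] pos
    by (auto simp: z_def field_simps)
  show ?thesis
  proof (cases "- w \<le> z")
    case True
    then show ?thesis using that[of i j0] z j0 t by (auto simp: z_def)
  next
    case False
    \<comment> \<open>The first row that brings the point to \<open>-w\<close> or further. A step is
      at most \<open>2 * w\<close>, so it cannot jump past \<open>w\<close>; and since
      \<open>z > w - p\<close>, the bound \<open>M\<close> ensures that row \<open>j1\<close> is not
      passed.\<close>
    define l where "l = \<lceil>(- w - z) / s\<rceil>"
    have l: "- w \<le> z + of_int l * s" "z + of_int l * s < - w + s"
      using ceiling_correct[of "(- w - z) / s", folded l_def] pos by (auto simp: field_simps)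
    have "- w - z \<le> s * of_int (j1 - j0)"
      using M z by linarith
    then have "(- w - z) / s \<le> of_int (j1 - j0)"
      using pos by (simp add: field_simps)
    then have "l \<le> j1 - j0"
      unfolding l_def by (rule ceiling_le)
    have "0 \<le> (- w - z) / s"
      using False pos by simp
    then have "0 \<le> l"
      unfolding l_def by linarith
    have "\<bar>x + of_int i * p + of_int (j0 + l) * s\<bar> \<le> w"
      using l s by (simp add: z_def algebra_simps)
    moreover have "of_int (j0 + l) * t \<le> of_int j1 * t" "of_int j0 * t \<le> of_int (j0 + l) * t"
      using \<open>l \<le> j1 - j0\<close> \<open>0 \<le> l\<close> pos by (auto intro!: mult_right_mono)
    then have "\<bar>y + of_int (j0 + l) * t\<bar> \<le> h"
      using j0 j1 by linarith
    ultimately show ?thesis by (rule that)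
  qed
qed

text \<open>Helly's theorem on the line: for pairwise meeting intervals the largest left endpoint
  lies in all of them.\<close>

lemma three_intervals_meet:
  fixes a b c u v w :: real
  assumes "0 \<le> u" "0 \<le> v" "0 \<le> w"
    and "\<bar>a - b\<bar> \<le> u + v" "\<bar>a - c\<bar> \<le> u + w" "\<bar>b - c\<bar> \<le> v + w"
  obtains d where "\<bar>d - a\<bar> \<le> u" "\<bar>d - b\<bar> \<le> v" "\<bar>d - c\<bar> \<le> w"
proof
  let ?d = "max (a - u) (max (b - v) (c - w))"
  show "\<bar>?d - a\<bar> \<le> u" "\<bar>?d - b\<bar> \<le> v" "\<bar>?d - c\<bar> \<le> w"
    using assms by (auto simp: max_def abs_le_iff)
qed

theorem theorem1:
  fixes n1 n2 n3 m :: int and r E1 :: real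
  assumes "n1 \<noteq> 0" "n2 \<noteq> 0" "n3 \<noteq> 0"
    and "\<bar>n1\<bar> \<noteq> \<bar>n2\<bar>" "\<bar>n1\<bar> \<noteq> \<bar>n3\<bar>" "\<bar>n2\<bar> \<noteq> \<bar>n3\<bar>"
    and "Gcd {n1, n2, n3} = 1"
    and "m = gcd n2 n3"
    and "r > 0"
    and "group_closure {(1 / of_int m, 0), (r / of_int n3, of_int m / of_int n3)} = lattice_K n1 n2 n3"
    and "E1 = Max {of_int m / (2 * (\<bar>of_int n2\<bar> + \<bar>of_int n3\<bar>)),
                   r / (2 * (\<bar>of_int n1\<bar> + \<bar>of_int n3\<bar>)),
                   (\<bar>of_int n3\<bar> + 2 * r * of_int m) /
                     (2 * (r * (\<bar>of_int n2\<bar> + \<bar>of_int n3\<bar>) + of_int m * (\<bar>of_int n1\<bar> + \<bar>of_int n3\<bar>)))}"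
  shows "angular_kronecker_const {n1, n2, n3} \<ge>
           \<bar>of_int n3\<bar> / (2 * (r * (\<bar>of_int n2\<bar> + \<bar>of_int n3\<bar>) + of_int m * (\<bar>of_int n1\<bar> + \<bar>of_int n3\<bar>))) \<and>
         angular_kronecker_const {n1, n2, n3} \<le>
           E1 * (2 * \<bar>of_int n1\<bar> * \<bar>of_int n2\<bar> + \<bar>of_int n3\<bar> * (\<bar>of_int n1\<bar> + \<bar>of_int n2\<bar>)) /
             (\<bar>of_int n3\<bar> * (\<bar>of_int n1\<bar> + \<bar>of_int n2\<bar>))"
proof -
  define \<nu>1 \<nu>2 \<nu>3 where \<nu>: "\<nu>1 = real_of_int n1" "\<nu>2 = real_of_int n2" "\<nu>3 = real_of_int n3"
  define \<mu> where "\<mu> = real_of_int m"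
  define D where "D = r * (\<bar>\<nu>2\<bar> + \<bar>\<nu>3\<bar>) + \<mu> * (\<bar>\<nu>1\<bar> + \<bar>\<nu>3\<bar>)"
  have nz: "\<nu>1 \<noteq> 0" "\<nu>2 \<noteq> 0" "\<nu>3 \<noteq> 0"
    using assms(1-3) by (auto simp: \<nu>)
  have "m > 0"
    using assms(3) by (simp add: assms(8) gcd_pos_int)
  then have "\<mu> > 0" by (simp add: \<mu>_def)
  have "D > 0"
    unfolding D_def using nz \<open>r > 0\<close> \<open>\<mu> > 0\<close> by (intro add_pos_pos mult_pos_pos) auto
  \<comment> \<open>The generation hypothesis in coordinates. It trades the integers
    \<open>a\<close>, \<open>b\<close>, \<open>c\<close> of the approximation problem for a row
    \<open>j\<close> and a position \<open>i\<close> in it, and back.\<close>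
  have lattice: "(\<exists>i j :: int. v = (of_int i * (1 / \<mu>) + of_int j * (r / \<nu>3), of_int j * (\<mu> / \<nu>3))) \<longleftrightarrow>
    (\<exists>a b c :: int. v = (of_int a + of_int c * (\<nu>1 / \<nu>3), of_int b + of_int c * (\<nu>2 / \<nu>3)))" for v
    unfolding \<nu> \<mu>_def group_closure_pair_iff[symmetric] lattice_K_iff[symmetric] assms(10) ..

  \<comment> \<open>Lower bound: a point that is hard to cover\<close>
  have "\<bar>\<nu>3\<bar> / (2 * D) \<le> angular_kronecker_const {n1, n2, n3}"
  proof (rule ccontr)
    define L where "L = \<bar>\<nu>3\<bar> / (2 * D)"
    have LD: "2 * L * D = \<bar>\<nu>3\<bar>"
      using \<open>D > 0\<close> by (simp add: L_def)
    \<comment> \<open>Eliminating \<open>x\<close> turns these phases into the point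
      \<open>(1/(2m), 0)\<close>. The values can be prescribed separately because \<open>n1\<close>
      differs from \<open>n2\<close> and \<open>n3\<close>.\<close>
    define \<theta> :: "int \<Rightarrow> real" where "\<theta> = (\<lambda>n. if n = n1 then - (1 / (2 * \<mu>)) else 0)"
    have \<theta>: "\<theta> n1 = - (1 / (2 * \<mu>))" "\<theta> n2 = 0" "\<theta> n3 = 0"
      using assms(4-6) by (auto simp: \<theta>_def)
    assume "\<not> ?thesis"
    then have "angular_kronecker_const {n1, n2, n3} < L"
      by (simp add: L_def)
    then obtain x where x: "\<And>n. n \<in> {n1, n2, n3} \<Longrightarrow> \<exists>k::int. \<bar>of_int n * x - \<theta> n - of_int k\<bar> < L"
      using angular_kronecker_const_less_approx[of "{n1, n2, n3}" L \<theta>] by blast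
    obtain a :: int where a: "\<bar>\<nu>1 * x + 1 / (2 * \<mu>) - of_int a\<bar> < L"
      using x[of n1] \<theta> by (auto simp: \<nu>)
    obtain b :: int where b: "\<bar>\<nu>2 * x - of_int b\<bar> < L"
      using x[of n2] \<theta> by (auto simp: \<nu>)
    obtain c :: int where c: "\<bar>\<nu>3 * x - of_int c\<bar> < L"
      using x[of n3] \<theta> by (auto simp: \<nu>)
    have L: "L > 0" using a by linarith
    define \<delta> where "\<delta> = \<nu>3 * x - of_int c"
    have x_eq: "x = (of_int c + \<delta>) / \<nu>3"
      using nz by (simp add: \<delta>_def)
    obtain i j :: int where ij: "of_int (- a) + of_int c * (\<nu>1 / \<nu>3) = of_int i * (1 / \<mu>) + of_int j * (r / \<nu>3)"
        "of_int (- b) + of_int c * (\<nu>2 / \<nu>3) = of_int j * (\<mu> / \<nu>3)"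
      using lattice[of "(of_int (- a) + of_int c * (\<nu>1 / \<nu>3), of_int (- b) + of_int c * (\<nu>2 / \<nu>3))"]
      by (metis prod.inject)
    \<comment> \<open>The height of row \<open>j\<close> is a combination of the errors at
      \<open>n2\<close> and \<open>n3\<close>, which limits how far away that row can be.\<close>
    have "of_int j * (\<mu> / \<nu>3) = (\<nu>2 * x - of_int b) - \<delta> * (\<nu>2 / \<nu>3)"
      unfolding ij(2)[symmetric] x_eq using nz by (simp add: field_simps)
    then have "\<bar>of_int j * (\<mu> / \<nu>3)\<bar> \<le> \<bar>\<nu>2 * x - of_int b\<bar> + \<bar>\<delta>\<bar> * (\<bar>\<nu>2\<bar> / \<bar>\<nu>3\<bar>)"
      by (simp flip: abs_mult abs_divide)
    also have "\<dots> < L + L * (\<bar>\<nu>2\<bar> / \<bar>\<nu>3\<bar>)"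
      using b c nz by (intro add_strict_mono mult_strict_right_mono) (auto simp: \<delta>_def)
    finally have j: "\<bar>of_int j\<bar> * \<mu> < L * (\<bar>\<nu>2\<bar> + \<bar>\<nu>3\<bar>)"
      using nz \<open>\<mu> > 0\<close> by (simp add: abs_mult field_simps)
    have "1 / (2 * \<mu>) + of_int i / \<mu> + of_int j * (r / \<nu>3) = (\<nu>1 * x + 1 / (2 * \<mu>) - of_int a) - \<delta> * (\<nu>1 / \<nu>3)"
      using nz ij(1) by (simp add: x_eq) (simp add: field_simps)
    moreover have "\<bar>u\<bar> \<le> \<bar>y\<bar> + \<bar>z\<bar> + \<bar>v\<bar>" if "u + v = y - z" for u v y z :: real
      using that by linarith
    ultimately have "\<bar>1 / (2 * \<mu>) + of_int i / \<mu>\<bar>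
        \<le> \<bar>\<nu>1 * x + 1 / (2 * \<mu>) - of_int a\<bar> + \<bar>\<delta> * (\<nu>1 / \<nu>3)\<bar> + \<bar>of_int j * (r / \<nu>3)\<bar>"
      by blast
    also have "\<dots> = \<bar>\<nu>1 * x + 1 / (2 * \<mu>) - of_int a\<bar> + \<bar>\<delta>\<bar> * (\<bar>\<nu>1\<bar> / \<bar>\<nu>3\<bar>) + \<bar>of_int j\<bar> * (r / \<bar>\<nu>3\<bar>)"
      using \<open>r > 0\<close> by (simp add: abs_mult)
    also have "\<dots> < L + L * (\<bar>\<nu>1\<bar> / \<bar>\<nu>3\<bar>) + \<bar>of_int j\<bar> * (r / \<bar>\<nu>3\<bar>)"
      using a c nz by (intro add_strict_mono add_strict_right_mono mult_strict_right_mono) (auto simp: \<delta>_def)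
    finally have i: "\<bar>1 / (2 * \<mu>) + of_int i / \<mu>\<bar> < L + L * (\<bar>\<nu>1\<bar> / \<bar>\<nu>3\<bar>) + \<bar>of_int j\<bar> * (r / \<bar>\<nu>3\<bar>)" .
    have "1 / (2 * \<mu>) \<le> \<bar>1 / (2 * \<mu>) + of_int i / \<mu>\<bar>"
    proof -
      \<comment> \<open>In units of \<open>1/(2m)\<close> the distance to be estimated is an odd
        integer.\<close>
      have "1 \<le> \<bar>1 + 2 * i\<bar>" by presburger
      then have "1 \<le> \<bar>1 + 2 * real_of_int i\<bar>" by linarith
      then have "1 / (2 * \<mu>) \<le> \<bar>1 + 2 * real_of_int i\<bar> / (2 * \<mu>)"
        using \<open>\<mu> > 0\<close> by (intro divide_right_mono) auto
      also have "\<dots> = \<bar>(1 + 2 * real_of_int i) / (2 * \<mu>)\<bar>"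
        using \<open>\<mu> > 0\<close> by simp
      also have "(1 + 2 * real_of_int i) / (2 * \<mu>) = 1 / (2 * \<mu>) + of_int i / \<mu>"
        using \<open>\<mu> > 0\<close> by (simp add: field_simps)
      finally show ?thesis .
    qed
    then have "1 / (2 * \<mu>) < L + L * (\<bar>\<nu>1\<bar> / \<bar>\<nu>3\<bar>) + \<bar>of_int j\<bar> * (r / \<bar>\<nu>3\<bar>)"
      using i by linarith
    \<comment> \<open>With denominators cleared, the row term contains exactly the product bounded
      in \<open>j\<close>. Inserting that bound yields \<open>2 * L * D\<close>, which is
      \<open>\<bar>\<nu>3\<bar>\<close> by the choice of \<open>L\<close>.\<close>
    then have "\<bar>\<nu>3\<bar> < 2 * \<mu> * L * (\<bar>\<nu>1\<bar> + \<bar>\<nu>3\<bar>) + 2 * r * (\<bar>of_int j\<bar> * \<mu>)"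
      using nz \<open>\<mu> > 0\<close> by (simp add: field_simps)
    also have "\<dots> < 2 * \<mu> * L * (\<bar>\<nu>1\<bar> + \<bar>\<nu>3\<bar>) + 2 * r * (L * (\<bar>\<nu>2\<bar> + \<bar>\<nu>3\<bar>))"
      using j \<open>r > 0\<close> by simp
    also have "\<dots> = 2 * L * D"
      by (simp add: D_def algebra_simps)
    finally show False using LD by simp
  qed

  \<comment> \<open>Upper bound: from a cover by rectangles to a simultaneous approximation\<close>
  moreover
  define E where "E = E1 * (2 * \<bar>\<nu>1\<bar> * \<bar>\<nu>2\<bar> + \<bar>\<nu>3\<bar> * (\<bar>\<nu>1\<bar> + \<bar>\<nu>2\<bar>)) / (\<bar>\<nu>3\<bar> * (\<bar>\<nu>1\<bar> + \<bar>\<nu>2\<bar>))"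
  \<comment> \<open>The entries of the maximum provide, in this order, the conditions
    \<open>t \<le> 2 * h\<close>, \<open>s \<le> 2 * w\<close> and the one on \<open>p\<close> in
    \<open>lattice_rectangle_cover\<close>.\<close>
  have E1: "\<mu> / (2 * (\<bar>\<nu>2\<bar> + \<bar>\<nu>3\<bar>)) \<le> E1" "r / (2 * (\<bar>\<nu>1\<bar> + \<bar>\<nu>3\<bar>)) \<le> E1"
      "(\<bar>\<nu>3\<bar> + 2 * r * \<mu>) / (2 * D) \<le> E1"
    unfolding assms(11) \<nu> \<mu>_def D_def by (rule Max_ge; simp)+
  have "0 < \<mu> / (2 * (\<bar>\<nu>2\<bar> + \<bar>\<nu>3\<bar>))"
    using \<open>\<mu> > 0\<close> nz by (intro divide_pos_pos) auto
  then have "E1 > 0" using E1 by linarith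
  \<comment> \<open>Multiplied by \<open>\<bar>\<nu>3\<bar> / (\<bar>\<nu>1\<bar> *
    \<bar>\<nu>2\<bar>)\<close>, the left side becomes the sum of the radii of two intervals for
    \<open>\<delta>\<close>, and the right side the bound on the distance of their centres.\<close>
  have E_eq: "E * (\<bar>\<nu>1\<bar> + \<bar>\<nu>2\<bar>) = E1 * (\<bar>\<nu>1\<bar> + \<bar>\<nu>2\<bar>) + 2 * E1 * (\<bar>\<nu>1\<bar> * \<bar>\<nu>2\<bar> / \<bar>\<nu>3\<bar>)"
  proof -
    have "\<bar>\<nu>1\<bar> + \<bar>\<nu>2\<bar> \<noteq> 0" "\<bar>\<nu>3\<bar> \<noteq> 0" using nz by auto
    moreover have "E1 * (2 * y * z + b * a) / (b * a) * a = E1 * a + 2 * E1 * (y * z / b)"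
      if "a \<noteq> 0" "b \<noteq> 0" for a b y z :: real
      using that by (simp add: field_simps)
    ultimately show ?thesis unfolding E_def by blast
  qed
  have "E1 * (\<bar>\<nu>1\<bar> + \<bar>\<nu>2\<bar>) \<le> E * (\<bar>\<nu>1\<bar> + \<bar>\<nu>2\<bar>)"
    unfolding E_eq using \<open>E1 > 0\<close> by simp
  then have "E1 \<le> E"
    using nz by (simp add: mult_le_cancel_right)
  have "angular_kronecker_const {n1, n2, n3} \<le> E"
  proof (rule angular_kronecker_const_le)
    show "0 \<le> E" using \<open>E1 > 0\<close> \<open>E1 \<le> E\<close> by simp
    fix \<theta> :: "int \<Rightarrow> real"
    \<comment> \<open>\<open>(X, Y)\<close> is what remains of the phases after eliminating
      \<open>x\<close>; a lattice translate of it has to land in the hexagon.\<close>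
    define X where "X = \<nu>1 / \<nu>3 * \<theta> n3 - \<theta> n1"
    define Y where "Y = \<nu>2 / \<nu>3 * \<theta> n3 - \<theta> n2"
    define w where "w = E1 * (1 + \<bar>\<nu>1\<bar> / \<bar>\<nu>3\<bar>)"
    define h where "h = E1 * (1 + \<bar>\<nu>2\<bar> / \<bar>\<nu>3\<bar>)"
    have w: "w * \<bar>\<nu>3\<bar> = E1 * (\<bar>\<nu>1\<bar> + \<bar>\<nu>3\<bar>)" and h: "h * \<bar>\<nu>3\<bar> = E1 * (\<bar>\<nu>2\<bar> + \<bar>\<nu>3\<bar>)"
      using nz by (simp_all add: w_def h_def field_simps)
    obtain i j :: int where
      ij: "\<bar>X + of_int i * (1 / \<mu>) + of_int j * (r / \<bar>\<nu>3\<bar>)\<bar> \<le> w" "\<bar>Y + of_int j * (\<mu> / \<bar>\<nu>3\<bar>)\<bar> \<le> h"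
    proof (rule lattice_rectangle_cover)
      show "0 < 1 / \<mu>" "0 < r / \<bar>\<nu>3\<bar>" "0 < \<mu> / \<bar>\<nu>3\<bar>"
        using \<open>\<mu> > 0\<close> \<open>r > 0\<close> nz by simp_all
      have pos: "\<bar>\<nu>1\<bar> + \<bar>\<nu>3\<bar> > 0" "\<bar>\<nu>2\<bar> + \<bar>\<nu>3\<bar> > 0" "\<bar>\<nu>3\<bar> > 0" using nz by auto
      have "\<mu> \<le> 2 * (h * \<bar>\<nu>3\<bar>)"
        using E1(1) pos unfolding h by (simp add: pos_divide_le_eq algebra_simps)
      then show "\<mu> / \<bar>\<nu>3\<bar> \<le> 2 * h"
        using pos by (simp add: pos_divide_le_eq algebra_simps)
      have "r \<le> 2 * (w * \<bar>\<nu>3\<bar>)"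
        using E1(2) pos unfolding w by (simp add: pos_divide_le_eq algebra_simps)
      then show "r / \<bar>\<nu>3\<bar> \<le> 2 * w"
        using pos by (simp add: pos_divide_le_eq algebra_simps)
      have "\<bar>\<nu>3\<bar> + 2 * r * \<mu> \<le> 2 * E1 * D"
        using E1(3) \<open>D > 0\<close> by (simp add: pos_divide_le_eq algebra_simps)
      also have "\<dots> = 2 * \<mu> * (w * \<bar>\<nu>3\<bar>) + 2 * r * (h * \<bar>\<nu>3\<bar>)"
        unfolding w h D_def by (simp add: algebra_simps)
      finally show "1 / \<mu> \<le> 2 * w + r / \<bar>\<nu>3\<bar> * (2 * h / (\<mu> / \<bar>\<nu>3\<bar>) - 2)"
        using pos \<open>\<mu> > 0\<close> by (simp add: field_simps)
    qed
    \<comment> \<open>The cover was made with positive steps, using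
      \<open>\<bar>\<nu>3\<bar>\<close>. For negative \<open>n3\<close> the second generator is
      reversed, which is undone by the sign of \<open>j\<close>.\<close>
    define j' where "j' = sgn n3 * j"
    have j': "of_int j' / \<nu>3 = of_int j / \<bar>\<nu>3\<bar>"
      using assms(3) by (cases "n3 > 0") (auto simp: j'_def \<nu>)
    have "of_int j' * (q / \<nu>3) = of_int j * (q / \<bar>\<nu>3\<bar>)" for q
      using arg_cong[OF j', of "\<lambda>z. z * q"] by simp
    note ij = ij[folded this]
    obtain a b c :: int where
      abc: "of_int i * (1 / \<mu>) + of_int j' * (r / \<nu>3) = of_int a + of_int c * (\<nu>1 / \<nu>3)"
        "of_int j' * (\<mu> / \<nu>3) = of_int b + of_int c * (\<nu>2 / \<nu>3)"
      using lattice[of "(of_int i * (1 / \<mu>) + of_int j' * (r / \<nu>3), of_int j' * (\<mu> / \<nu>3))"]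
      by (metis prod.inject)
    define U where "U = X + of_int a + of_int c * (\<nu>1 / \<nu>3)"
    define V where "V = Y + of_int b + of_int c * (\<nu>2 / \<nu>3)"
    have U: "\<bar>U\<bar> \<le> w" and V: "\<bar>V\<bar> \<le> h"
      using ij abc by (simp_all add: U_def V_def add.assoc)
    \<comment> \<open>The requirements at \<open>n3\<close>, \<open>n1\<close> and \<open>n2\<close>
      each confine \<open>\<delta>\<close> to an interval, so a common point of the three is
      sought.\<close>
    obtain \<delta> where \<delta>: "\<bar>\<delta> - 0\<bar> \<le> E" "\<bar>\<delta> - (- U * \<nu>3 / \<nu>1)\<bar> \<le> E * \<bar>\<nu>3\<bar> / \<bar>\<nu>1\<bar>"
      "\<bar>\<delta> - (- V * \<nu>3 / \<nu>2)\<bar> \<le> E * \<bar>\<nu>3\<bar> / \<bar>\<nu>2\<bar>"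
    proof (rule three_intervals_meet)
      show "0 \<le> E" "0 \<le> E * \<bar>\<nu>3\<bar> / \<bar>\<nu>1\<bar>" "0 \<le> E * \<bar>\<nu>3\<bar> / \<bar>\<nu>2\<bar>"
        using \<open>0 \<le> E\<close> by simp_all
      have U': "\<bar>U * \<nu>3 / \<nu>1\<bar> \<le> E1 + E1 * \<bar>\<nu>3\<bar> / \<bar>\<nu>1\<bar>"
      proof -
        have "\<bar>U * \<nu>3 / \<nu>1\<bar> \<le> w * \<bar>\<nu>3\<bar> / \<bar>\<nu>1\<bar>"
          unfolding abs_mult abs_divide using U by (intro divide_right_mono mult_right_mono) auto
        also have "\<dots> = E1 + E1 * \<bar>\<nu>3\<bar> / \<bar>\<nu>1\<bar>"
          unfolding w using nz by (simp add: field_simps)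
        finally show ?thesis .
      qed
      have V': "\<bar>V * \<nu>3 / \<nu>2\<bar> \<le> E1 + E1 * \<bar>\<nu>3\<bar> / \<bar>\<nu>2\<bar>"
      proof -
        have "\<bar>V * \<nu>3 / \<nu>2\<bar> \<le> h * \<bar>\<nu>3\<bar> / \<bar>\<nu>2\<bar>"
          unfolding abs_mult abs_divide using V by (intro divide_right_mono mult_right_mono) auto
        also have "\<dots> = E1 + E1 * \<bar>\<nu>3\<bar> / \<bar>\<nu>2\<bar>"
          unfolding h using nz by (simp add: field_simps)
        finally show ?thesis .
      qed
      have E1_le: "E1 * \<bar>\<nu>3\<bar> / \<bar>q\<bar> \<le> E * \<bar>\<nu>3\<bar> / \<bar>q\<bar>" for q
        using \<open>E1 \<le> E\<close> by (intro divide_right_mono mult_right_mono) auto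
      show "\<bar>0 - (- U * \<nu>3 / \<nu>1)\<bar> \<le> E + E * \<bar>\<nu>3\<bar> / \<bar>\<nu>1\<bar>"
        using U' E1_le[of \<nu>1] \<open>E1 \<le> E\<close> by simp
      show "\<bar>0 - (- V * \<nu>3 / \<nu>2)\<bar> \<le> E + E * \<bar>\<nu>3\<bar> / \<bar>\<nu>2\<bar>"
        using V' E1_le[of \<nu>2] \<open>E1 \<le> E\<close> by simp
      \<comment> \<open>This is the critical pair. Against the interval around 0 the radii belonging
        to \<open>E1\<close> suffice, but here the bounds on \<open>U\<close> and \<open>V\<close>
        add up, and \<open>E\<close> is chosen to absorb their sum.\<close>
      have "\<bar>- U * \<nu>3 / \<nu>1 - (- V * \<nu>3 / \<nu>2)\<bar> \<le> \<bar>U * \<nu>3 / \<nu>1\<bar> + \<bar>V * \<nu>3 / \<nu>2\<bar>"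
        unfolding mult_minus_left minus_divide_left[symmetric] by linarith
      also have "\<dots> \<le> (E1 * (\<bar>\<nu>1\<bar> + \<bar>\<nu>2\<bar>) + 2 * E1 * (\<bar>\<nu>1\<bar> * \<bar>\<nu>2\<bar> / \<bar>\<nu>3\<bar>)) * \<bar>\<nu>3\<bar> / (\<bar>\<nu>1\<bar> * \<bar>\<nu>2\<bar>)"
      proof -
        have "(E1 * (\<bar>\<nu>1\<bar> + \<bar>\<nu>2\<bar>) + 2 * E1 * (\<bar>\<nu>1\<bar> * \<bar>\<nu>2\<bar> / \<bar>\<nu>3\<bar>)) * \<bar>\<nu>3\<bar> / (\<bar>\<nu>1\<bar> * \<bar>\<nu>2\<bar>)
            = (E1 + E1 * \<bar>\<nu>3\<bar> / \<bar>\<nu>1\<bar>) + (E1 + E1 * \<bar>\<nu>3\<bar> / \<bar>\<nu>2\<bar>)"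
          using nz by (simp add: field_simps)
        then show ?thesis using U' V' by linarith
      qed
      also have "\<dots> = E * \<bar>\<nu>3\<bar> / \<bar>\<nu>1\<bar> + E * \<bar>\<nu>3\<bar> / \<bar>\<nu>2\<bar>"
        unfolding E_eq[symmetric] using nz by (simp add: field_simps)
      finally show "\<bar>- U * \<nu>3 / \<nu>1 - (- V * \<nu>3 / \<nu>2)\<bar> \<le> E * \<bar>\<nu>3\<bar> / \<bar>\<nu>1\<bar> + E * \<bar>\<nu>3\<bar> / \<bar>\<nu>2\<bar>" .
    qed
    have slope: "\<bar>W + \<nu> / \<nu>3 * \<delta>\<bar> \<le> E"
      if "\<bar>\<delta> - (- W * \<nu>3 / \<nu>)\<bar> \<le> E * \<bar>\<nu>3\<bar> / \<bar>\<nu>\<bar>" "\<nu> \<noteq> 0" for W \<nu>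
    proof -
      have "W + \<nu> / \<nu>3 * \<delta> = \<nu> / \<nu>3 * (\<delta> - (- W * \<nu>3 / \<nu>))"
        using nz that(2) by (simp add: field_simps)
      then have "\<bar>W + \<nu> / \<nu>3 * \<delta>\<bar> = \<bar>\<nu>\<bar> / \<bar>\<nu>3\<bar> * \<bar>\<delta> - (- W * \<nu>3 / \<nu>)\<bar>"
        by (simp only: abs_mult abs_divide)
      also have "\<dots> \<le> \<bar>\<nu>\<bar> / \<bar>\<nu>3\<bar> * (E * \<bar>\<nu>3\<bar> / \<bar>\<nu>\<bar>)"
        using that(1) by (intro mult_left_mono) auto
      also have "\<dots> = E" using nz that(2) by simp
      finally show ?thesis .
    qed
    \<comment> \<open>This solves \<open>\<nu>3 * x = \<theta> n3 + c + \<delta>\<close>; the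
      lattice coefficients \<open>-a\<close>, \<open>-b\<close> and \<open>c\<close> become the
      nearby integers.\<close>
    define x where "x = (\<theta> n3 + of_int c + \<delta>) / \<nu>3"
    have "of_int n1 * x - \<theta> n1 - of_int (- a) = U + \<nu>1 / \<nu>3 * \<delta>"
      using nz by (simp add: x_def U_def X_def flip: \<nu>) (simp add: field_simps)
    then have 1: "\<bar>of_int n1 * x - \<theta> n1 - of_int (- a)\<bar> \<le> E"
      using slope[OF \<delta>(2) nz(1)] by simp
    have "of_int n2 * x - \<theta> n2 - of_int (- b) = V + \<nu>2 / \<nu>3 * \<delta>"
      using nz by (simp add: x_def V_def Y_def flip: \<nu>) (simp add: field_simps)
    then have 2: "\<bar>of_int n2 * x - \<theta> n2 - of_int (- b)\<bar> \<le> E"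
      using slope[OF \<delta>(3) nz(2)] by simp
    have 3: "\<bar>of_int n3 * x - \<theta> n3 - of_int c\<bar> \<le> E"
      using nz \<delta>(1) by (simp add: x_def flip: \<nu>)
    show "\<exists>x. \<forall>n\<in>{n1, n2, n3}. \<exists>k::int. \<bar>of_int n * x - \<theta> n - of_int k\<bar> \<le> E"
      using 1 2 3 by blast
  qed
  ultimately show ?thesis
    by (simp add: E_def D_def \<nu> \<mu>_def)
qed

end
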